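(* Let $k$ be a field of characteristic $\neq 2$, let $A$ be a Jordan algebra over $k$ of codimension $1$ in the vector space $E$ (i.e. $A$ is a subspace of $E$ of codimension $1$), and let $V$ be a complement of $A$ in $E$. Then the relation $\equiv$ on flag data (defined in the context) is an equivalence relation on the set $\mathcal{F}(A)$ of all flag data of $A$, and there are bijections $$\mathrm{Jext}(E,A)\cong\mathcal{J}_A(V,A)\cong\mathcal{F}(A)/\equiv.$$ The bijection between $\mathcal{F}(A)/\equiv$ and $\mathrm{Jext}(E,A)$ is given by $$\overline{(D,\lambda,a_0,\alpha_0)}\mapsto A_{(D,\lambda,a_0,\alpha_0)},$$ where $\overline{(D,\lambda,a_0,\alpha_0)}$ is the equivalence class of $(D,\lambda,a_0,\alpha_0)$ under $\equiv$, and, for a fixed basis $\{x\}$ of $V$, $A_{(D,\lambda,a_0,\alpha_0)}$ is regarded as (the class of) a Jordan algebra structure on $E=A\oplus kx$.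
   Context: $k$ is a field of characteristic $\neq 2$; all vector spaces and (bi)linear maps are over $k$. A Jordan algebra is a vector space $A$ with a commutative bilinear multiplication $\cdot$ satisfying $(a^2\cdot b)\cdot a=a^2\cdot(b\cdot a)$ for all $a,b$ (no unit assumed). $\mathrm{Jext}(E,A)$: the set of equivalence classes of Jordan algebra structures on $E$ containing $A$ as a subalgebra, two structures $\cdot_E,\cdot_E'$ being equivalent if there is a Jordan algebra isomorphism $\varphi:(E,\cdot_E)\to(E,\cdot_E')$ with $\varphi(a)=a$ for all $a\in A$. $\mathcal{J}_A(V,A)$: An extending datum of $A$ through $V$ is a system $(\triangleleft,\triangleright,f,\cdot_V)$ of bilinear maps $\triangleleft:V\times A\to V$, $\triangleright:V\times A\to A$, $f:V\times V\to A$, $\cdot_V:V\times V\to V$; it is a Jordan extending structure if $A\times V$ with multiplication $(a,x)\circ(b,y)=(a\cdot b+x\triangleright b+y\triangleright a+f(x,y),\,x\triangleleft b+y\triangleleft a+x\cdot_Vy)$ is a Jordan algebra. Two Jordan extending structures are equivalent if there are a linear map $r:V\to A$ and $v\in\mathrm{Aut}_k(V)$ such that for all $a\in A$, $x,y\in V$, with $\bar x=v^{-1}(x)$, $\bar y=v^{-1}(y)$: $x\triangleleft'a=v(\bar x\triangleleft a)$; $x\triangleright'a=r(\bar x\triangleleft a)+\bar x\triangleright a-a\cdot r(\bar x)$; $f'(x,y)=f(\bar x,\bar y)+r(\bar x\cdot_V\bar y)+r(\bar x)\cdot r(\bar y)-r(\bar x\triangleleft r(\bar y))-\bar x\triangleright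 r(\bar y)-r(\bar y\triangleleft r(\bar x))-\bar y\triangleright r(\bar x)$; $x\cdot_V'y=v(\bar x\cdot_V\bar y)-v(\bar x\triangleleft r(\bar y))-v(\bar y\triangleleft r(\bar x))$. $\mathcal{J}_A(V,A)$ is the set of equivalence classes of Jordan extending structures of $A$ through $V$. Flag data: a flag datum of $A$ is a system $(D,\lambda,a_0,\alpha_0)\in\mathrm{End}_k(A)\times A^*\times A\times k$ (with $A^*=\mathrm{Hom}_k(A,k)$) such that $A_{(D,\lambda,a_0,\alpha_0)}$ is a Jordan algebra, where $A_{(D,\lambda,a_0,\alpha_0)}$ is the vector space $A\oplus kx$ with the commutative bilinear multiplication determined, for $a,b\in A$, by $$a\circ b=a\cdot b,\qquad a\circ x=x\circ a=D(a)+\lambda(a)x,\qquad x\circ x=a_0+\alpha_0x.$$ $\mathcal{F}(A)$ is the set of all flag data of $A$. Two flag data satisfy $(D,\lambda,a_0,\alpha_0)\equiv(D',\lambda',a_0',\alpha_0')$ if $\lambda=\lambda'$ and there exists $(r,u)\in A\times k^*$ such that for all $a\in A$: $$D(a)=u\,D'(a)+a\cdot r-\lambda'(a)\,r,\quad \alpha_0=u\,\alpha_0'+2\lambda'(r),\quad a_0=u^2a_0'+r\cdot r+2u\,D'(r)-u\,\alpha_0'\,r-2\lambda'(r)\,r.$$ *)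

theory Defs
  imports "HOL-Analysis.Product_Vector" "HOL-Library.FuncSet"
begin

text \<open>
  The ambient space \<open>E\<close> is a whole type with scalar multiplication \<open>smul\<close>; \<open>A\<close> and \<open>V\<close> are subspaces
  given as sets. Maps defined on \<open>A\<close> or \<open>V\<close> only are taken from the extensional function space
  \<open>\<rightarrow>\<^sub>E\<close>, so that equality of such maps is equality on the carrier.
\<close>

definition linear_on ::
  "('k \<Rightarrow> 'b \<Rightarrow> 'b) \<Rightarrow> ('k \<Rightarrow> 'c \<Rightarrow> 'c) \<Rightarrow> 'b::ab_group_add set \<Rightarrow> 'c::ab_group_add set \<Rightarrow> ('b \<Rightarrow> 'c) \<Rightarrow> bool"
  where "linear_on s1 s2 S T f \<longleftrightarrow>
    f \<in> S \<rightarrow> T \<and>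
    (\<forall>x\<in>S. \<forall>y\<in>S. f (x + y) = f x + f y) \<and>
    (\<forall>c. \<forall>x\<in>S. f (s1 c x) = s2 c (f x))"

definition bilinear_on ::
  "('k \<Rightarrow> 'b \<Rightarrow> 'b) \<Rightarrow> 'b::ab_group_add set \<Rightarrow> 'b set \<Rightarrow> 'b set \<Rightarrow> ('b \<Rightarrow> 'b \<Rightarrow> 'b) \<Rightarrow> bool"
  where "bilinear_on s S T U f \<longleftrightarrow>
    (\<forall>x\<in>S. linear_on s s T U (\<lambda>y. f x y)) \<and>
    (\<forall>y\<in>T. linear_on s s S U (\<lambda>x. f x y))"

definition jordan_algebra_on ::
  "('k::field \<Rightarrow> 'b \<Rightarrow> 'b) \<Rightarrow> 'b::ab_group_add set \<Rightarrow> ('b \<Rightarrow> 'b \<Rightarrow> 'b) \<Rightarrow> bool"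
  where "jordan_algebra_on s S m \<longleftrightarrow>
    module.subspace s S \<and>
    bilinear_on s S S S m \<and>
    (\<forall>a\<in>S. \<forall>b\<in>S. m a b = m b a) \<and>
    (\<forall>a\<in>S. \<forall>b\<in>S. m (m (m a a) b) a = m (m a a) (m b a))"

definition is_complement ::
  "('k::field \<Rightarrow> 'e \<Rightarrow> 'e) \<Rightarrow> 'e::ab_group_add set \<Rightarrow> 'e set \<Rightarrow> bool"
  where "is_complement smul A V \<longleftrightarrow>
    module.subspace smul A \<and> module.subspace smul V \<and>
    A \<inter> V = {0} \<and> (\<forall>e. \<exists>a\<in>A. \<exists>v\<in>V. e = a + v)"

definition is_basis_of ::
  "('k::field \<Rightarrow> 'e \<Rightarrow> 'e) \<Rightarrow> 'e::ab_group_add set \<Rightarrow> 'e set \<Rightarrow> bool"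
  where "is_basis_of smul B V \<longleftrightarrow> \<not> module.dependent smul B \<and> module.span smul B = V"

text \<open>
  The quotient \<open>E / A\<close> is not available as a vector space; its dimension is the dimension of
  a complement of \<open>A\<close>.
\<close>

definition has_codim ::
  "('k::field \<Rightarrow> 'e \<Rightarrow> 'e) \<Rightarrow> 'e::ab_group_add set \<Rightarrow> nat \<Rightarrow> bool"
  where "has_codim smul A n \<longleftrightarrow>
    (\<exists>W B. is_complement smul A W \<and> is_basis_of smul B W \<and> finite B \<and> card B = n)"


definition jordan_extensions ::
  "('k::field \<Rightarrow> 'e \<Rightarrow> 'e) \<Rightarrow> 'e::ab_group_add set \<Rightarrow> ('e \<Rightarrow> 'e \<Rightarrow> 'e) \<Rightarrow> ('e \<Rightarrow> 'e \<Rightarrow> 'e) set"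
  where "jordan_extensions smul A m =
    {mE. jordan_algebra_on smul UNIV mE \<and> (\<forall>a\<in>A. \<forall>b\<in>A. mE a b = m a b)}"

definition ext_equiv ::
  "('k::field \<Rightarrow> 'e \<Rightarrow> 'e) \<Rightarrow> 'e::ab_group_add set \<Rightarrow> ('e \<Rightarrow> 'e \<Rightarrow> 'e) \<Rightarrow> ('e \<Rightarrow> 'e \<Rightarrow> 'e) rel"
  where "ext_equiv smul A m =
    {(mE, mE'). mE \<in> jordan_extensions smul A m \<and> mE' \<in> jordan_extensions smul A m \<and>
      (\<exists>\<phi>. Vector_Spaces.linear smul smul \<phi> \<and> bij \<phi> \<and>
           (\<forall>y z. \<phi> (mE y z) = mE' (\<phi> y) (\<phi> z)) \<and> (\<forall>a\<in>A. \<phi> a = a))}"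

definition Jext ::
  "('k::field \<Rightarrow> 'e \<Rightarrow> 'e) \<Rightarrow> 'e::ab_group_add set \<Rightarrow> ('e \<Rightarrow> 'e \<Rightarrow> 'e) \<Rightarrow> ('e \<Rightarrow> 'e \<Rightarrow> 'e) set set"
  where "Jext smul A m = jordan_extensions smul A m // ext_equiv smul A m"


text \<open>A datum \<open>(tl, tr, f, mV)\<close> stands for \<open>(\<triangleleft>, \<triangleright>, f, \<cdot>\<^sub>V)\<close>.\<close>

type_synonym 'e ext_datum =
  "('e \<Rightarrow> 'e \<Rightarrow> 'e) \<times> ('e \<Rightarrow> 'e \<Rightarrow> 'e) \<times> ('e \<Rightarrow> 'e \<Rightarrow> 'e) \<times> ('e \<Rightarrow> 'e \<Rightarrow> 'e)"

definition extending_data ::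
  "('k::field \<Rightarrow> 'e \<Rightarrow> 'e) \<Rightarrow> 'e::ab_group_add set \<Rightarrow> 'e set \<Rightarrow> 'e ext_datum set"
  where "extending_data smul A V =
    {(tl, tr, f, mV).
      tl \<in> V \<rightarrow>\<^sub>E A \<rightarrow>\<^sub>E V \<and> bilinear_on smul V A V tl \<and>
      tr \<in> V \<rightarrow>\<^sub>E A \<rightarrow>\<^sub>E A \<and> bilinear_on smul V A A tr \<and>
      f \<in> V \<rightarrow>\<^sub>E V \<rightarrow>\<^sub>E A \<and> bilinear_on smul V V A f \<and>
      mV \<in> V \<rightarrow>\<^sub>E V \<rightarrow>\<^sub>E V \<and> bilinear_on smul V V V mV}"

definition unified_product ::
  "('e \<Rightarrow> 'e \<Rightarrow> 'e) \<Rightarrow> 'e ext_datum \<Rightarrow> 'e::ab_group_add \<times> 'e \<Rightarrow> 'e \<times> 'e \<Rightarrow> 'e \<times> 'e"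
  where "unified_product m = (\<lambda>(tl, tr, f, mV) (a, x) (b, y).
    (m a b + tr x b + tr y a + f x y, tl x b + tl y a + mV x y))"

definition jordan_extending_structures ::
  "('k::field \<Rightarrow> 'e \<Rightarrow> 'e) \<Rightarrow> 'e::ab_group_add set \<Rightarrow> ('e \<Rightarrow> 'e \<Rightarrow> 'e) \<Rightarrow> 'e set \<Rightarrow> 'e ext_datum set"
  where "jordan_extending_structures smul A m V =
    {d \<in> extending_data smul A V.
      jordan_algebra_on (module_prod.scale smul smul) (A \<times> V) (unified_product m d)}"

definition datum_equiv ::
  "('k::field \<Rightarrow> 'e \<Rightarrow> 'e) \<Rightarrow> 'e::ab_group_add set \<Rightarrow> ('e \<Rightarrow> 'e \<Rightarrow> 'e) \<Rightarrow> 'e set \<Rightarrow> 'e ext_datum rel"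
  where "datum_equiv smul A m V =
    {((tl, tr, f, mV), (tl', tr', f', mV')).
      (tl, tr, f, mV) \<in> jordan_extending_structures smul A m V \<and>
      (tl', tr', f', mV') \<in> jordan_extending_structures smul A m V \<and>
      (\<exists>r v. linear_on smul smul V A r \<and> linear_on smul smul V V v \<and> bij_betw v V V \<and>
        (\<forall>a\<in>A. \<forall>x\<in>V. \<forall>y\<in>V.
          let x1 = inv_into V v x; y1 = inv_into V v y in
            tl' x a = v (tl x1 a) \<and>
            tr' x a = r (tl x1 a) + tr x1 a - m a (r x1) \<and>
            f' x y = f x1 y1 + r (mV x1 y1) + m (r x1) (r y1)
                     - r (tl x1 (r y1)) - tr x1 (r y1) - r (tl y1 (r x1)) - tr y1 (r x1) \<and>
            mV' x y = v (mV x1 y1) - v (tl x1 (r y1)) - v (tl y1 (r x1))))}"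

definition J_classes ::
  "('k::field \<Rightarrow> 'e \<Rightarrow> 'e) \<Rightarrow> 'e::ab_group_add set \<Rightarrow> ('e \<Rightarrow> 'e \<Rightarrow> 'e) \<Rightarrow> 'e set \<Rightarrow> 'e ext_datum set set"
  where "J_classes smul A m V = jordan_extending_structures smul A m V // datum_equiv smul A m V"


text \<open>A datum \<open>(D, l, a0, \<alpha>0)\<close> stands for \<open>(D, \<lambda>, a\<^sub>0, \<alpha>\<^sub>0)\<close>.\<close>

type_synonym ('k, 'e) flag_datum = "('e \<Rightarrow> 'e) \<times> ('e \<Rightarrow> 'k) \<times> 'e \<times> 'k"

text \<open>
  The space \<open>A \<oplus> kx\<close> is modelled as \<open>A \<times> k\<close>, the pair \<open>(a, s)\<close> standing for \<open>a + s x\<close>; the formula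
  is the commutative bilinear expansion of \<open>(a + s x) \<circ> (b + t x)\<close>.
\<close>

definition flag_mult ::
  "('k::field \<Rightarrow> 'e \<Rightarrow> 'e) \<Rightarrow> ('e \<Rightarrow> 'e \<Rightarrow> 'e) \<Rightarrow> ('k, 'e) flag_datum
    \<Rightarrow> 'e::ab_group_add \<times> 'k \<Rightarrow> 'e \<times> 'k \<Rightarrow> 'e \<times> 'k"
  where "flag_mult smul m = (\<lambda>(D, l, a0, \<alpha>0) (a, s) (b, t).
    (m a b + smul t (D a) + smul s (D b) + smul (s * t) a0,
     t * l a + s * l b + s * t * \<alpha>0))"

definition flag_data ::
  "('k::field \<Rightarrow> 'e \<Rightarrow> 'e) \<Rightarrow> 'e::ab_group_add set \<Rightarrow> ('e \<Rightarrow> 'e \<Rightarrow> 'e) \<Rightarrow> ('k, 'e) flag_datum set"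
  where "flag_data smul A m =
    {(D, l, a0, \<alpha>0).
      D \<in> A \<rightarrow>\<^sub>E A \<and> linear_on smul smul A A D \<and>
      l \<in> A \<rightarrow>\<^sub>E UNIV \<and> linear_on smul (*) A UNIV l \<and>
      a0 \<in> A \<and>
      jordan_algebra_on (module_prod.scale smul (*)) (A \<times> UNIV) (flag_mult smul m (D, l, a0, \<alpha>0))}"

definition flag_equiv ::
  "('k::field \<Rightarrow> 'e \<Rightarrow> 'e) \<Rightarrow> 'e::ab_group_add set \<Rightarrow> ('e \<Rightarrow> 'e \<Rightarrow> 'e) \<Rightarrow> ('k, 'e) flag_datum rel"
  where "flag_equiv smul A m =
    {((D, l, a0, \<alpha>0), (D', l', a0', \<alpha>0')).
      (D, l, a0, \<alpha>0) \<in> flag_data smul A m \<and> (D', l', a0', \<alpha>0') \<in> flag_data smul A m \<and>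
      l = l' \<and>
      (\<exists>r\<in>A. \<exists>u. u \<noteq> 0 \<and>
        (\<forall>a\<in>A. D a = smul u (D' a) + m a r - smul (l' a) r) \<and>
        \<alpha>0 = u * \<alpha>0' + 2 * l' r \<and>
        a0 = smul (u\<^sup>2) a0' + m r r + smul (2 * u) (D' r) - smul (u * \<alpha>0') r - smul (2 * l' r) r)}"

text \<open>The multiplication of \<open>A\<^bsub>(D, \<lambda>, a\<^sub>0, \<alpha>\<^sub>0)\<^esub>\<close> carried over to \<open>E\<close> along \<open>(a, s) \<mapsto> a + s x\<close>.\<close>

definition flag_extension ::
  "('k::field \<Rightarrow> 'e \<Rightarrow> 'e) \<Rightarrow> 'e::ab_group_add set \<Rightarrow> ('e \<Rightarrow> 'e \<Rightarrow> 'e) \<Rightarrow> 'e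
    \<Rightarrow> ('k, 'e) flag_datum \<Rightarrow> 'e \<Rightarrow> 'e \<Rightarrow> 'e"
  where "flag_extension smul A m x q y z =
    (let \<theta> = (\<lambda>(a, s). a + smul s x); \<theta>' = inv_into (A \<times> UNIV) \<theta>
     in \<theta> (flag_mult smul m q (\<theta>' y) (\<theta>' z)))"

end

theory Submission
  imports Defs
begin

text \<open>
  Writing elements of \<open>E\<close> in components along \<open>A \<oplus> V\<close> (respectively \<open>A \<oplus> kx\<close>) makes the extending
  structures (respectively the flag data) correspond one-to-one to the Jordan structures on \<open>E\<close> that
  extend \<open>A\<close>. An isomorphism fixing \<open>A\<close> pointwise has the form \<open>a + y \<mapsto> (a + r y) + v y\<close>, with \<open>r\<close>
  linear from \<open>V\<close> to \<open>A\<close> and \<open>v\<close> an automorphism of \<open>V\<close>; on \<open>kx\<close> this is a vector \<open>r\<close> of \<open>A\<close> and a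
  nonzero scalar \<open>u\<close>. Comparing components of products shows that such a map is multiplicative
  exactly under the equations defining the equivalence of data, so both bijections descend to the
  quotients, and the relation on flag data is the pullback of an equivalence relation.
\<close>

section \<open>Quotients and extensional functions\<close>

text \<open>Each axiom is read off at the images under \<open>F\<close>. This gives the first claim
  of the theorem without any computation in the formulas of \<open>flag_equiv\<close>, once that
  relation is known to mean isomorphism of the extensions.\<close>

lemma equiv_pullback:
  assumes "equiv T R'" "F \<in> S \<rightarrow> T" "R \<subseteq> S \<times> S"
    and "\<And>x y. x \<in> S \<Longrightarrow> y \<in> S \<Longrightarrow> (x, y) \<in> R \<longleftrightarrow> (F x, F y) \<in> R'"
  shows "equiv S R"
proof (rule equivI)
  show "R \<subseteq> S \<times> S" by fact
  show "refl_on S R"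
    using assms(1,2,4) by (auto simp: refl_on_def equiv_def Pi_iff)
  show "sym R"
    using assms(1,3,4) by (auto simp: sym_def equiv_def)
  show "trans R"
  proof (rule transI)
    fix x y z assume "(x, y) \<in> R" "(y, z) \<in> R"
    moreover from this have "x \<in> S" "y \<in> S" "z \<in> S" using assms(3) by auto
    ultimately show "(x, z) \<in> R"
      using assms(1,4) by (meson equivE transD)
  qed
qed

text \<open>Because \<open>F\<close> is onto and matches the relations, it carries each class of
  \<open>R\<close> onto a full class of \<open>R'\<close>. Hence taking images of sets is the
  induced map of quotients. The second conclusion keeps its values on classes, which the explicit
  form of the flag bijection requires.\<close>

lemma bij_betw_quotient:
  assumes R': "equiv T R'" and F: "bij_betw F S T" and sub: "R \<subseteq> S \<times> S"
    and iff: "\<And>x y. x \<in> S \<Longrightarrow> y \<in> S \<Longrightarrow> (x, y) \<in> R \<longleftrightarrow> (F x, F y) \<in> R'"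
  obtains \<Theta> where "bij_betw \<Theta> (S // R) (T // R')" "\<forall>x\<in>S. \<Theta> (R `` {x}) = R' `` {F x}"
proof -
  have im: "F ` (R `` {x}) = R' `` {F x}" if "x \<in> S" for x
  proof
    show "F ` (R `` {x}) \<subseteq> R' `` {F x}"
      using that sub iff by blast
    show "R' `` {F x} \<subseteq> F ` (R `` {x})"
    proof
      fix t assume t: "t \<in> R' `` {F x}"
      then have "t \<in> T" using R' by (auto simp: equiv_def)
      then obtain y where "y \<in> S" "t = F y" using F by (auto simp: bij_betw_def)
      with t that iff show "t \<in> F ` (R `` {x})" by auto
    qed
  qed
  have "bij_betw (image F) (S // R) (T // R')"
  proof (rule bij_betw_imageI)
    have "C \<subseteq> S" if "C \<in> S // R" for C
      using that sub by (auto simp: quotient_def)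
    then show "inj_on (image F) (S // R)"
      using F by (meson bij_betw_imp_inj_on inj_on_image_eq_iff inj_onI)
    show "image F ` (S // R) = T // R'"
    proof
      show "image F ` (S // R) \<subseteq> T // R'"
        using im F by (auto simp: quotient_def bij_betw_def)
      show "T // R' \<subseteq> image F ` (S // R)"
      proof
        fix C assume "C \<in> T // R'"
        then obtain x where "x \<in> S" "C = R' `` {F x}"
          using F by (auto simp: quotient_def bij_betw_def)
        then show "C \<in> image F ` (S // R)"
          using im by (auto simp: quotient_def)
      qed
    qed
  qed
  with im that show ?thesis by blast
qed

lemma PiE2_eqI:
  assumes "f \<in> S \<rightarrow>\<^sub>E T \<rightarrow>\<^sub>E U" "g \<in> S \<rightarrow>\<^sub>E T \<rightarrow>\<^sub>E U" "\<And>x y. x \<in> S \<Longrightarrow> y \<in> T \<Longrightarrow> f x y = g x y"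
  shows "f = g"
  using assms(1,2)
proof (rule PiE_ext)
  fix x assume "x \<in> S"
  then show "f x = g x"
    using assms by (intro PiE_ext[of "f x" T "\<lambda>_. U" "g x"]) auto
qed

text \<open>A change of variables along the permutation \<open>v\<close> of \<open>S\<close>. It
  clears the inverses from the equations that define equivalence of extending structures.\<close>

lemma ball_inv_into:
  assumes "bij_betw v S S"
  shows "(\<forall>x\<in>S. \<forall>y\<in>S. P (inv_into S v x) (inv_into S v y) x y) \<longleftrightarrow>
    (\<forall>x\<in>S. \<forall>y\<in>S. P x y (v x) (v y))"
proof -
  have "v x \<in> S" "inv_into S v (v x) = x" "v (inv_into S v x) = x" "inv_into S v x \<in> S"
    if "x \<in> S" for x
    using assms that by (auto simp: bij_betw_def inv_into_into f_inv_into_f)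
  then show ?thesis by metis
qed

section \<open>Transport of Jordan algebras\<close>

lemma linear_onD:
  assumes "linear_on s1 s2 S T f"
  shows "x \<in> S \<Longrightarrow> f x \<in> T"
    and "x \<in> S \<Longrightarrow> y \<in> S \<Longrightarrow> f (x + y) = f x + f y"
    and "x \<in> S \<Longrightarrow> f (s1 c x) = s2 c (f x)"
  using assms by (auto simp: linear_on_def)

lemma bilinear_onD:
  assumes "bilinear_on s S T U f"
  shows "x \<in> S \<Longrightarrow> y \<in> T \<Longrightarrow> f x y \<in> U"
    and "x \<in> S \<Longrightarrow> x' \<in> S \<Longrightarrow> y \<in> T \<Longrightarrow> f (x + x') y = f x y + f x' y"
    and "x \<in> S \<Longrightarrow> y \<in> T \<Longrightarrow> y' \<in> T \<Longrightarrow> f x (y + y') = f x y + f x y'"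
    and "x \<in> S \<Longrightarrow> y \<in> T \<Longrightarrow> f (s c x) y = s c (f x y)"
    and "x \<in> S \<Longrightarrow> y \<in> T \<Longrightarrow> f x (s c y) = s c (f x y)"
  using assms by (auto simp: bilinear_on_def linear_on_def Pi_iff)

lemma bilinear_onI:
  assumes "\<And>x y. x \<in> S \<Longrightarrow> y \<in> T \<Longrightarrow> f x y \<in> U"
    and "\<And>x x' y. x \<in> S \<Longrightarrow> x' \<in> S \<Longrightarrow> y \<in> T \<Longrightarrow> f (x + x') y = f x y + f x' y"
    and "\<And>x y y'. x \<in> S \<Longrightarrow> y \<in> T \<Longrightarrow> y' \<in> T \<Longrightarrow> f x (y + y') = f x y + f x y'"
    and "\<And>c x y. x \<in> S \<Longrightarrow> y \<in> T \<Longrightarrow> f (s c x) y = s c (f x y)"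
    and "\<And>c x y. x \<in> S \<Longrightarrow> y \<in> T \<Longrightarrow> f x (s c y) = s c (f x y)"
  shows "bilinear_on s S T U f"
  using assms by (auto simp: bilinear_on_def linear_on_def Pi_iff)

text \<open>Every element of \<open>T\<close> is some \<open>\<theta> x\<close>, so each axiom for
  \<open>mT\<close> is the image of the same axiom for \<open>mS\<close>. It is applied both from a
  product space to \<open>E\<close> and from \<open>E\<close> to a product space.\<close>

lemma jordan_algebra_on_transport:
  assumes m1: "module s1" and m2: "module s2" and sub: "module.subspace s2 T"
    and lin: "linear_on s1 s2 S T \<theta>" and onto: "\<theta> ` S = T"
    and jord: "jordan_algebra_on s1 S mS"
    and hom: "\<And>x y. x \<in> S \<Longrightarrow> y \<in> S \<Longrightarrow> mT (\<theta> x) (\<theta> y) = \<theta> (mS x y)"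
  shows "jordan_algebra_on s2 T mT"
proof -
  interpret M1: module s1 by fact
  interpret M2: module s2 by fact
  have S: "M1.subspace S" and bil: "bilinear_on s1 S S S mS"
    and comm: "\<And>x y. x \<in> S \<Longrightarrow> y \<in> S \<Longrightarrow> mS x y = mS y x"
    and jid: "\<And>x y. x \<in> S \<Longrightarrow> y \<in> S \<Longrightarrow> mS (mS (mS x x) y) x = mS (mS x x) (mS y x)"
    using jord by (auto simp: jordan_algebra_on_def)
  note b = bilinear_onD[OF bil] and l = linear_onD[OF lin]
  note cl = M1.subspace_add[OF S] M1.subspace_scale[OF S]
  \<comment> \<open>Oriented so that sums and multiples of images collapse to the image of one
    element, where \<open>hom\<close> applies.\<close>
  have add: "\<theta> x + \<theta> y = \<theta> (x + y)" if "x \<in> S" "y \<in> S" for x y using l that by simp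
  have scale: "s2 c (\<theta> x) = \<theta> (s1 c x)" if "x \<in> S" for x c using l that by simp
  have "bilinear_on s2 T T T mT"
    unfolding onto[symmetric]
    by (rule bilinear_onI) (auto simp: hom add scale b cl)
  moreover have "mT x y = mT y x" if "x \<in> T" "y \<in> T" for x y
    using that unfolding onto[symmetric] by (auto simp: hom comm)
  moreover have "mT (mT (mT x x) y) x = mT (mT x x) (mT y x)" if "x \<in> T" "y \<in> T" for x y
    using that unfolding onto[symmetric] by (auto simp: hom jid b)
  ultimately show ?thesis
    using sub by (simp add: jordan_algebra_on_def)
qed

section \<open>Extensions of a Jordan algebra to a space with a fixed complement\<close>

locale complemented_jordan = vector_space smul
  for smul :: "'k::field \<Rightarrow> 'e::ab_group_add \<Rightarrow> 'e" +
  fixes A V :: "'e set" and m :: "'e \<Rightarrow> 'e \<Rightarrow> 'e"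
  assumes jordan: "jordan_algebra_on smul A m"
    and complement: "is_complement smul A V"
begin

lemma subspace_A: "subspace A" and subspace_V: "subspace V"
  using complement by (auto simp: is_complement_def)

lemmas closed =
  subspace_0[OF subspace_A] subspace_add[OF subspace_A] subspace_diff[OF subspace_A]
  subspace_scale[OF subspace_A] subspace_neg[OF subspace_A]
  subspace_0[OF subspace_V] subspace_add[OF subspace_V] subspace_diff[OF subspace_V]
  subspace_scale[OF subspace_V] subspace_neg[OF subspace_V]

lemma bilinear_m: "bilinear_on smul A A A m"
  using jordan by (simp add: jordan_algebra_on_def)

lemma m_commute: "a \<in> A \<Longrightarrow> b \<in> A \<Longrightarrow> m a b = m b a"
  using jordan by (simp add: jordan_algebra_on_def)

lemma in_both: "e \<in> A \<Longrightarrow> e \<in> V \<Longrightarrow> e = 0"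
  using complement by (auto simp: is_complement_def)

section \<open>Projections along the decomposition into \<open>A\<close> and
  \<open>V\<close>\<close>

lemma decomposition_unique:
  assumes "a \<in> A" "b \<in> A" "v \<in> V" "w \<in> V" "a + v = b + w"
  shows "a = b" "v = w"
proof -
  have "a - b = w - v" using assms(5) by (simp add: algebra_simps)
  moreover have "a - b \<in> A" "w - v \<in> V" using assms closed by auto
  ultimately have "a - b = 0" using in_both[of "a - b"] by simp
  then show "a = b" "v = w" using assms(5) by auto
qed

text \<open>The projection onto \<open>A\<close> along \<open>V\<close>; \<open>pv\<close> below is
  the complementary projection onto \<open>V\<close>.\<close>

definition pa :: "'e \<Rightarrow> 'e" where "pa e = (THE a. a \<in> A \<and> e - a \<in> V)"
definition pv :: "'e \<Rightarrow> 'e" where "pv e = e - pa e"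

lemma pa_eq: "a \<in> A \<Longrightarrow> v \<in> V \<Longrightarrow> pa (a + v) = a"
  unfolding pa_def
  by (rule the_equality) (auto intro: decomposition_unique(1)[of _ a "a + v - _" v])

lemma pv_eq: "a \<in> A \<Longrightarrow> v \<in> V \<Longrightarrow> pv (a + v) = v"
  by (simp add: pv_def pa_eq)

lemma decomposition:
  obtains a v where "a \<in> A" "v \<in> V" "e = a + v"
  using complement by (metis is_complement_def)

lemma pa_in: "pa e \<in> A" and pv_in: "pv e \<in> V" and pa_pv: "pa e + pv e = e"
  using decomposition[of e] by (metis pa_eq, metis pv_eq, simp add: pv_def)

lemma pa_A: "a \<in> A \<Longrightarrow> pa a = a" and pv_A: "a \<in> A \<Longrightarrow> pv a = 0"
  and pa_V: "v \<in> V \<Longrightarrow> pa v = 0" and pv_V: "v \<in> V \<Longrightarrow> pv v = v"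
  using pa_eq[of a 0] pv_eq[of a 0] pa_eq[of 0 v] pv_eq[of 0 v] closed by simp_all

lemma pa_add: "pa (e + e') = pa e + pa e'" and pv_add: "pv (e + e') = pv e + pv e'"
proof -
  have "e + e' = (pa e + pa e') + (pv e + pv e')"
    using pa_pv[of e] pa_pv[of e'] by (metis add.assoc add.left_commute)
  then show "pa (e + e') = pa e + pa e'" "pv (e + e') = pv e + pv e'"
    by (simp_all only: pa_eq pv_eq closed pa_in pv_in)
qed

lemma pa_scale: "pa (smul c e) = smul c (pa e)" and pv_scale: "pv (smul c e) = smul c (pv e)"
proof -
  have "smul c e = smul c (pa e) + smul c (pv e)"
    by (metis pa_pv scale_right_distrib)
  then show "pa (smul c e) = smul c (pa e)" "pv (smul c e) = smul c (pv e)"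
    by (simp_all only: pa_eq pv_eq closed pa_in pv_in)
qed

lemma eq_iff_components: "e = e' \<longleftrightarrow> pa e = pa e' \<and> pv e = pv e'"
  by (metis pa_pv)

lemma extension_props:
  assumes "M \<in> jordan_extensions smul A m"
  shows "M (x + x') y = M x y + M x' y" "M x (y + y') = M x y + M x y'"
    and "M (smul c x) y = smul c (M x y)" "M x (smul c y) = smul c (M x y)"
    and "M x y = M y x"
    and "a \<in> A \<Longrightarrow> b \<in> A \<Longrightarrow> M a b = m a b"
  using assms
  by (auto simp: jordan_extensions_def jordan_algebra_on_def bilinear_on_def linear_on_def)

section \<open>Isomorphisms that fix \<open>A\<close> pointwise\<close>

lemma linear_iff_add_scale:
  "Vector_Spaces.linear smul smul \<phi> \<longleftrightarrow>
    (\<forall>y z. \<phi> (y + z) = \<phi> y + \<phi> z) \<and> (\<forall>c y. \<phi> (smul c y) = smul c (\<phi> y))"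
  using vector_space_axioms by (auto simp: Vector_Spaces.linear_iff)

definition fixing_iso :: "('e \<Rightarrow> 'e \<Rightarrow> 'e) \<Rightarrow> ('e \<Rightarrow> 'e \<Rightarrow> 'e) \<Rightarrow> ('e \<Rightarrow> 'e) \<Rightarrow> bool"
  where "fixing_iso M M' \<phi> \<longleftrightarrow> Vector_Spaces.linear smul smul \<phi> \<and> bij \<phi> \<and>
    (\<forall>y z. \<phi> (M y z) = M' (\<phi> y) (\<phi> z)) \<and> (\<forall>a\<in>A. \<phi> a = a)"

lemma ext_equiv_iff_fixing_iso:
  "(M, M') \<in> ext_equiv smul A m \<longleftrightarrow>
    M \<in> jordan_extensions smul A m \<and> M' \<in> jordan_extensions smul A m \<and>
    (\<exists>\<phi>. fixing_iso M M' \<phi>)"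
  by (simp add: ext_equiv_def fixing_iso_def)

lemma fixing_isoD:
  assumes "fixing_iso M M' \<phi>"
  shows "Vector_Spaces.linear smul smul \<phi>" "bij \<phi>"
    and "\<phi> (M y z) = M' (\<phi> y) (\<phi> z)" "a \<in> A \<Longrightarrow> \<phi> a = a"
  using assms by (simp_all add: fixing_iso_def)

lemma fixing_iso_id: "fixing_iso M M id"
  by (simp add: fixing_iso_def linear_iff_add_scale)

lemma fixing_iso_inv:
  assumes "fixing_iso M M' \<phi>"
  shows "fixing_iso M' M (inv \<phi>)"
proof -
  note \<phi> = fixing_isoD[OF assms]
  have inv: "\<phi> (inv \<phi> y) = y" "inv \<phi> (\<phi> y) = y" for y
    using \<phi>(2) by (simp_all add: bij_is_surj surj_f_inv_f bij_is_inj)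
  have \<phi>_lin: "\<phi> (y + z) = \<phi> y + \<phi> z" "\<phi> (smul c y) = smul c (\<phi> y)" for y z c
    using \<phi>(1) by (auto simp: linear_iff_add_scale)
  have "inv \<phi> (y + z) = inv \<phi> y + inv \<phi> z" "inv \<phi> (smul c y) = smul c (inv \<phi> y)" for y z c
    using \<phi>_lin(1)[of "inv \<phi> y" "inv \<phi> z"] inv(2)[of "inv \<phi> y + inv \<phi> z"]
      \<phi>_lin(2)[of c "inv \<phi> y"] inv(2)[of "smul c (inv \<phi> y)"] by (simp_all add: inv(1))
  then have "Vector_Spaces.linear smul smul (inv \<phi>)"
    by (simp add: linear_iff_add_scale)
  moreover have "bij (inv \<phi>)" using \<phi>(2) by (rule bij_imp_bij_inv)
  moreover have "inv \<phi> (M' y z) = M (inv \<phi> y) (inv \<phi> z)" for y z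
    using \<phi>(3)[of "inv \<phi> y" "inv \<phi> z"] inv(2)[of "M (inv \<phi> y) (inv \<phi> z)"] by (simp add: inv(1))
  moreover have "inv \<phi> a = a" if "a \<in> A" for a
    using \<phi>(4)[OF that] inv(2)[of a] by simp
  ultimately show ?thesis unfolding fixing_iso_def by simp
qed

lemma fixing_iso_comp:
  assumes "fixing_iso M M' \<phi>" "fixing_iso M' M'' \<psi>"
  shows "fixing_iso M M'' (\<psi> \<circ> \<phi>)"
  using assms by (simp add: fixing_iso_def linear_iff_add_scale bij_comp)

text \<open>Identities, inverses and composites of isomorphisms give the three axioms. This is the
  only relation treated directly; the one on flag data inherits the property by pullback.\<close>

lemma equiv_ext_equiv: "equiv (jordan_extensions smul A m) (ext_equiv smul A m)"
proof (rule equivI)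
  show "ext_equiv smul A m \<subseteq> jordan_extensions smul A m \<times> jordan_extensions smul A m"
    by (auto simp: ext_equiv_def)
  show "refl_on (jordan_extensions smul A m) (ext_equiv smul A m)"
    by (auto intro: fixing_iso_id simp: refl_on_def ext_equiv_iff_fixing_iso)
  show "sym (ext_equiv smul A m)"
    by (rule symI) (auto dest: fixing_iso_inv simp: ext_equiv_iff_fixing_iso)
  show "trans (ext_equiv smul A m)"
    by (rule transI) (auto dest: fixing_iso_comp simp: ext_equiv_iff_fixing_iso)
qed

text \<open>In block form with respect to \<open>A\<close> and \<open>V\<close>, the triangular map
  with the identity on \<open>A\<close>, \<open>v\<close> on \<open>V\<close>, and \<open>r\<close>
  as the off-diagonal block. Every linear map fixing \<open>A\<close> pointwise has this
  shape.\<close>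

definition stab :: "('e \<Rightarrow> 'e) \<Rightarrow> ('e \<Rightarrow> 'e) \<Rightarrow> 'e \<Rightarrow> 'e"
  where "stab r v e = pa e + r (pv e) + v (pv e)"

text \<open>Invertibility follows from triangularity: the \<open>V\<close> component of the image
  determines \<open>pv e\<close> through \<open>v\<close>, after which the \<open>A\<close>
  component determines \<open>pa e\<close>.\<close>

lemma stab_linear_bij:
  assumes r: "linear_on smul smul V A r" and v: "linear_on smul smul V V v"
    and bij: "bij_betw v V V"
  shows "Vector_Spaces.linear smul smul (stab r v)" "bij (stab r v)" "\<forall>a\<in>A. stab r v a = a"
    "\<forall>x\<in>V. stab r v x = r x + v x"
proof -
  note R = linear_onD[OF r] and L = linear_onD[OF v]
  have r0: "r 0 = 0" using R(3)[OF closed(6), of 0] by simp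
  have v0: "v 0 = 0" using L(3)[OF closed(6), of 0] by simp
  show "Vector_Spaces.linear smul smul (stab r v)"
    by (auto simp: linear_iff_add_scale stab_def pa_add pv_add pa_scale pv_scale R L pv_in
        scale_right_distrib algebra_simps)
  show "\<forall>a\<in>A. stab r v a = a" by (simp add: stab_def pa_A pv_A r0 v0)
  show "\<forall>x\<in>V. stab r v x = r x + v x" by (simp add: stab_def pa_V pv_V)
  show "bij (stab r v)"
  proof (rule bijI)
    show "inj (stab r v)"
    proof (rule injI)
      fix e e' assume "stab r v e = stab r v e'"
      then have "pa e + r (pv e) + v (pv e) = pa e' + r (pv e') + v (pv e')"
        by (simp add: stab_def)
      from decomposition_unique[OF _ _ _ _ this]
      have "pa e + r (pv e) = pa e' + r (pv e')" "v (pv e) = v (pv e')"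
        by (simp_all add: closed pa_in pv_in R L)
      moreover from this have "pv e = pv e'"
        using bij pv_in by (auto simp: bij_betw_def dest: inj_onD)
      ultimately show "e = e'"
        by (subst eq_iff_components) simp
    qed
    show "surj (stab r v)"
    proof (rule surjI)
      fix e
      \<comment> \<open>Back substitution: first solve \<open>v x = pv e\<close>, then correct the
        \<open>A\<close> component by \<open>r x\<close>.\<close>
      define x where "x = inv_into V v (pv e)"
      have x: "x \<in> V" "v x = pv e"
        using bij pv_in by (auto simp: x_def bij_betw_def inv_into_into f_inv_into_f)
      have "stab r v ((pa e - r x) + x) = (pa e - r x) + r x + v x"
        unfolding stab_def using x by (simp only: pa_eq pv_eq closed pa_in R)
      then show "stab r v ((pa e - r (inv_into V v (pv e))) + inv_into V v (pv e)) = e"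
        using x by (simp add: pa_pv x_def)
    qed
  qed
qed

text \<open>Multiplicativity of \<open>stab r v\<close> has to be tested only on \<open>V\<close>
  times \<open>A\<close> and \<open>V\<close> times \<open>V\<close>: on \<open>A\<close> both
  structures restrict to \<open>m\<close>, and commutativity covers \<open>A\<close> times
  \<open>V\<close>.\<close>

lemma ext_equiv_iff:
  assumes M: "M \<in> jordan_extensions smul A m" and M': "M' \<in> jordan_extensions smul A m"
  shows "(M, M') \<in> ext_equiv smul A m \<longleftrightarrow>
    (\<exists>r v. linear_on smul smul V A r \<and> linear_on smul smul V V v \<and> bij_betw v V V \<and>
      (\<forall>x\<in>V. \<forall>a\<in>A. stab r v (M x a) = M' (r x + v x) a) \<and>
      (\<forall>x\<in>V. \<forall>y\<in>V. stab r v (M x y) = M' (r x + v x) (r y + v y)))"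
    (is "?L \<longleftrightarrow> ?R")
proof
  assume ?L
  then obtain \<phi> where "fixing_iso M M' \<phi>"
    by (auto simp: ext_equiv_iff_fixing_iso)
  note \<phi> = fixing_isoD[OF this]
  have lin: "\<phi> (y + z) = \<phi> y + \<phi> z" "\<phi> (smul c y) = smul c (\<phi> y)" for y z c
    using \<phi>(1) by (auto simp: linear_iff_add_scale)
  \<comment> \<open>The components of \<open>\<phi>\<close>. Since \<open>\<phi>\<close> fixes
    \<open>A\<close>, its restriction to \<open>V\<close> determines it, and \<open>stab r v\<close>
    recovers it.\<close>
  define r where "r x = pa (\<phi> x)" for x
  define v where "v x = pv (\<phi> x)" for x
  have rv: "r x + v x = \<phi> x" for x by (simp add: r_def v_def pa_pv)
  have stab: "stab r v e = \<phi> e" for e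
  proof -
    have "stab r v e = pa e + \<phi> (pv e)" by (simp add: stab_def add.assoc rv)
    also have "\<dots> = \<phi> (pa e + pv e)" by (simp add: lin \<phi>(4) pa_in)
    finally show ?thesis by (simp add: pa_pv)
  qed
  have r: "linear_on smul smul V A r" and v: "linear_on smul smul V V v"
    by (auto simp: linear_on_def r_def v_def lin pa_add pv_add pa_scale pv_scale pa_in pv_in)
  have "bij_betw v V V"
  proof (rule bij_betw_imageI)
    show "inj_on v V"
    proof (rule inj_onI)
      fix x y assume xy: "x \<in> V" "y \<in> V" "v x = v y"
      \<comment> \<open>If \<open>v x = v y\<close>, then \<open>\<phi> x\<close> and
        \<open>\<phi> y\<close> differ only in \<open>A\<close>. Adding the opposite
        \<open>A\<close> components, which \<open>\<phi>\<close> fixes, makes the images equal, so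
        injectivity of \<open>\<phi>\<close> applies.\<close>
      have "\<phi> (x + r y) = \<phi> (y + r x)"
        using rv[of x] rv[of y] xy
        by (simp add: lin \<phi>(4) linear_onD[OF r]) (metis add.assoc add.commute)
      then have "x + r y = y + r x" using \<phi>(2) by (simp add: bij_is_inj inj_eq)
      then show "x = y"
        using decomposition_unique(2)[of "r y" "r x" x y] xy linear_onD[OF r]
        by (simp add: add.commute)
    qed
    show "v ` V = V"
    proof
      show "v ` V \<subseteq> V" by (auto simp: v_def pv_in)
      show "V \<subseteq> v ` V"
      proof
        fix y assume y: "y \<in> V"
        \<comment> \<open>The \<open>V\<close> component of \<open>\<phi> e\<close> depends only on
          \<open>pv e\<close>, so \<open>pv e\<close> is the required preimage of \<open>y\<close>
          under \<open>v\<close>.\<close>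
        obtain e where e: "\<phi> e = y" using \<phi>(2) by (metis bij_pointE)
        have "y = \<phi> (pa e + pv e)" by (simp add: pa_pv e)
        also have "\<dots> = (pa e + r (pv e)) + v (pv e)"
          by (simp add: lin \<phi>(4) pa_in add.assoc rv)
        finally have "pv y = v (pv e)"
          using pv_eq[of "pa e + r (pv e)" "v (pv e)"] by (simp add: closed pa_in r_def v_def pv_in)
        then show "y \<in> v ` V" using y pv_in by (auto simp: pv_V)
      qed
    qed
  qed
  then show ?R
    using r v by (intro exI[of _ r] exI[of _ v]) (simp add: stab rv \<phi>)
next
  assume ?R
  then obtain r v where r: "linear_on smul smul V A r" and v: "linear_on smul smul V V v"
    and bij: "bij_betw v V V"
    and va: "\<And>x a. x \<in> V \<Longrightarrow> a \<in> A \<Longrightarrow> stab r v (M x a) = M' (r x + v x) a"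
    and vv: "\<And>x y. x \<in> V \<Longrightarrow> y \<in> V \<Longrightarrow> stab r v (M x y) = M' (r x + v x) (r y + v y)"
    by blast
  note s = stab_linear_bij[OF r v bij]
  note P = extension_props[OF M] and P' = extension_props[OF M']
  have lin: "stab r v (y + z) = stab r v y + stab r v z" for y z
    using s(1) by (auto simp: linear_iff_add_scale)
  have "stab r v (M y z) = M' (stab r v y) (stab r v z)" for y z
  proof -
    obtain a x where a: "a \<in> A" "x \<in> V" "y = a + x" by (rule decomposition)
    obtain b w where b: "b \<in> A" "w \<in> V" "z = b + w" by (rule decomposition)
    \<comment> \<open>Commutativity turns \<open>M a w\<close> into \<open>M w a\<close>, the order
      in which the hypothesis \<open>va\<close> covers mixed products.\<close>
    have "stab r v (M y z) = stab r v (M a b) + stab r v (M w a) + stab r v (M x b) + stab r v (M x w)"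
      using P(5)[of w a] by (simp add: a b P(1,2) lin add_ac)
    also have "\<dots> = M' a b + M' (r w + v w) a + M' (r x + v x) b + M' (r x + v x) (r w + v w)"
      using a b s(3) bilinear_onD(1)[OF bilinear_m] by (simp add: va vv P(6) P'(6))
    also have "\<dots> = M' (a + (r x + v x)) (b + (r w + v w))"
      by (simp only: P'(1,2) P'(5)[of a "r w"] P'(5)[of a "v w"] add_ac)
    finally show ?thesis using a b s by (simp add: lin)
  qed
  with s(1-3) have "fixing_iso M M' (stab r v)" by (simp add: fixing_iso_def)
  with M M' show ?L by (auto simp: ext_equiv_iff_fixing_iso)
qed


section \<open>Extending structures\<close>

lemma components_eq_iff:
  "a \<in> A \<Longrightarrow> b \<in> A \<Longrightarrow> v \<in> V \<Longrightarrow> w \<in> V \<Longrightarrow> a + v = b + w \<longleftrightarrow> a = b \<and> v = w"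
  using decomposition_unique by blast

lemma bilinear_on_zero:
  assumes "bilinear_on smul S T U f"
  shows "0 \<in> S \<Longrightarrow> y \<in> T \<Longrightarrow> f 0 y = 0" "0 \<in> T \<Longrightarrow> x \<in> S \<Longrightarrow> f x 0 = 0"
  using bilinear_onD(4)[OF assms, of 0 y 0] bilinear_onD(5)[OF assms, of x 0 0] by simp_all

text \<open>The unified product on \<open>A \<times> V\<close>, carried to \<open>E\<close> along
  \<open>(a, v) \<mapsto> a + v\<close>.\<close>

definition datum_mult :: "'e ext_datum \<Rightarrow> 'e \<Rightarrow> 'e \<Rightarrow> 'e"
  where "datum_mult d y z =
    (case unified_product m d (pa y, pv y) (pa z, pv z) of (a, v) \<Rightarrow> a + v)"

lemma structure_props:
  assumes "(la, ra, f, mV) \<in> jordan_extending_structures smul A m V"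
  shows "bilinear_on smul V A V la" "bilinear_on smul V A A ra"
    "bilinear_on smul V V A f" "bilinear_on smul V V V mV"
    "la \<in> V \<rightarrow>\<^sub>E A \<rightarrow>\<^sub>E V" "ra \<in> V \<rightarrow>\<^sub>E A \<rightarrow>\<^sub>E A" "f \<in> V \<rightarrow>\<^sub>E V \<rightarrow>\<^sub>E A" "mV \<in> V \<rightarrow>\<^sub>E V \<rightarrow>\<^sub>E V"
  using assms by (simp_all add: jordan_extending_structures_def extending_data_def)

lemma datum_mult_eq:
  assumes "a \<in> A" "b \<in> A" "x \<in> V" "y \<in> V"
  shows "datum_mult (la, ra, f, mV) (a + x) (b + y) =
    (m a b + ra x b + ra y a + f x y) + (la x b + la y a + mV x y)"
  using assms by (simp add: datum_mult_def unified_product_def pa_eq pv_eq)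

text \<open>Cases of \<open>datum_mult_eq\<close> with zero components, where the bilinear terms
  vanish. The last two show that the four maps of a datum are the components of products of
  \<open>V\<close> with \<open>A\<close> and with itself.\<close>

lemma datum_mult_values:
  assumes d: "(la, ra, f, mV) \<in> jordan_extending_structures smul A m V"
  shows "a \<in> A \<Longrightarrow> b \<in> A \<Longrightarrow> datum_mult (la, ra, f, mV) a b = m a b"
    and "a \<in> A \<Longrightarrow> b \<in> A \<Longrightarrow> x \<in> V \<Longrightarrow>
      datum_mult (la, ra, f, mV) (b + x) a = (m b a + ra x a) + la x a"
    and "a \<in> A \<Longrightarrow> x \<in> V \<Longrightarrow> datum_mult (la, ra, f, mV) x a = ra x a + la x a"
    and "x \<in> V \<Longrightarrow> y \<in> V \<Longrightarrow> datum_mult (la, ra, f, mV) x y = f x y + mV x y"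
proof -
  note Z = structure_props(1-4)[OF d, THEN bilinear_on_zero(1)]
    structure_props(1-4)[OF d, THEN bilinear_on_zero(2)]
    bilinear_on_zero[OF bilinear_m]
  show "datum_mult (la, ra, f, mV) a b = m a b" if "a \<in> A" "b \<in> A"
    using datum_mult_eq[of a b 0 0 la ra f mV] that by (simp add: closed Z)
  show 1: "datum_mult (la, ra, f, mV) (b + x) a = (m b a + ra x a) + la x a"
    if "a \<in> A" "b \<in> A" "x \<in> V" for a b x
    using datum_mult_eq[of b a x 0 la ra f mV] that by (simp add: closed Z)
  show "datum_mult (la, ra, f, mV) x a = ra x a + la x a" if "a \<in> A" "x \<in> V"
    using 1[of a 0 x] that by (simp add: closed Z)
  show "datum_mult (la, ra, f, mV) x y = f x y + mV x y" if "x \<in> V" "y \<in> V"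
    using datum_mult_eq[of 0 0 x y la ra f mV] that by (simp add: closed Z)
qed

lemma module_prod_smul: "module_prod smul smul"
  by unfold_locales

lemma module_prod_smul_mult: "module_prod smul ((*) :: 'k \<Rightarrow> 'k \<Rightarrow> 'k)"
  by unfold_locales (auto simp: algebra_simps)

lemma datum_mult_in_extensions:
  assumes "d \<in> jordan_extending_structures smul A m V"
  shows "datum_mult d \<in> jordan_extensions smul A m"
proof -
  interpret P: module_prod smul smul by (rule module_prod_smul)
  have "jordan_algebra_on smul UNIV (datum_mult d)"
  proof (rule jordan_algebra_on_transport)
    show "module P.scale" "module smul" "subspace UNIV"
      by (simp_all add: P.p.module_axioms module_axioms)
    show "linear_on P.scale smul (A \<times> V) UNIV (\<lambda>(a, v). a + v)"
      by (auto simp: linear_on_def P.scale_prod scale_right_distrib)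
    show "(\<lambda>(a, v). a + v) ` (A \<times> V) = UNIV"
      by (auto simp: image_iff) (metis pa_in pv_in pa_pv)
    show "jordan_algebra_on P.scale (A \<times> V) (unified_product m d)"
      using assms by (simp add: jordan_extending_structures_def)
  qed (auto simp: datum_mult_def pa_eq pv_eq)
  with assms show ?thesis
    by (cases d) (auto simp: jordan_extensions_def datum_mult_values)
qed

text \<open>The datum is read off from components of products. That determines the four maps on
  their carriers, which is enough because they are extensional.\<close>

lemma inj_on_datum_mult: "inj_on datum_mult (jordan_extending_structures smul A m V)"
proof (rule inj_onI)
  fix d d'
  assume "d \<in> jordan_extending_structures smul A m V" "d' \<in> jordan_extending_structures smul A m V"
    and eq: "datum_mult d = datum_mult d'"
  moreover obtain la ra f mV la' ra' f' mV'
    where dd: "d = (la, ra, f, mV)" "d' = (la', ra', f', mV')" by (metis prod_cases4)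
  ultimately have d: "(la, ra, f, mV) \<in> jordan_extending_structures smul A m V"
    and d': "(la', ra', f', mV') \<in> jordan_extending_structures smul A m V" by auto
  note p = structure_props[OF d] and p' = structure_props[OF d']
  have "ra x a = ra' x a \<and> la x a = la' x a" if "x \<in> V" "a \<in> A" for x a
    using eq datum_mult_values(3)[OF d] datum_mult_values(3)[OF d'] that
      components_eq_iff[of "ra x a" "ra' x a" "la x a" "la' x a"]
      p(1,2)[THEN bilinear_onD(1)] p'(1,2)[THEN bilinear_onD(1)]
    by (simp add: dd)
  moreover have "f x y = f' x y \<and> mV x y = mV' x y" if "x \<in> V" "y \<in> V" for x y
    using eq datum_mult_values(4)[OF d] datum_mult_values(4)[OF d'] that
      components_eq_iff[of "f x y" "f' x y" "mV x y" "mV' x y"]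
      p(3,4)[THEN bilinear_onD(1)] p'(3,4)[THEN bilinear_onD(1)]
    by (simp add: dd)
  ultimately show "d = d'"
    using PiE2_eqI[OF p(5) p'(5)] PiE2_eqI[OF p(6) p'(6)]
      PiE2_eqI[OF p(7) p'(7)] PiE2_eqI[OF p(8) p'(8)] by (simp add: dd)
qed

lemma datum_mult_surj:
  assumes M: "M \<in> jordan_extensions smul A m"
  shows "M \<in> datum_mult ` jordan_extending_structures smul A m V"
proof -
  interpret P: module_prod smul smul by (rule module_prod_smul)
  note E = extension_props[OF M]
  \<comment> \<open>The only candidate, by \<open>datum_mult_values\<close>; the restrictions to
    \<open>V\<close> and \<open>A\<close> make the maps extensional.\<close>
  define d where "d = ((\<lambda>x\<in>V. \<lambda>a\<in>A. pv (M x a)), (\<lambda>x\<in>V. \<lambda>a\<in>A. pa (M x a)),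
    (\<lambda>x\<in>V. \<lambda>y\<in>V. pa (M x y)), (\<lambda>x\<in>V. \<lambda>y\<in>V. pv (M x y)))"
  have data: "d \<in> extending_data smul A V"
    by (auto simp: d_def extending_data_def pa_in pv_in closed E(1-4)
        pa_add pv_add pa_scale pv_scale intro!: bilinear_onI)
  have prod: "unified_product m d (pa e, pv e) (pa e', pv e') = (pa (M e e'), pv (M e e'))" for e e'
  proof -
    have "M e e' = M (pa e + pv e) (pa e' + pv e')" by (simp add: pa_pv)
    also have "\<dots> = m (pa e) (pa e') + M (pv e) (pa e') + M (pv e') (pa e) + M (pv e) (pv e')"
      by (simp only: E(1,2) E(5)[of "pa e" "pv e'"] E(6)[OF pa_in pa_in] add_ac)
    finally show ?thesis
      by (simp add: d_def unified_product_def pa_add pv_add pa_in pv_in pa_A pv_A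
          bilinear_onD(1)[OF bilinear_m])
  qed
  have "jordan_algebra_on P.scale (A \<times> V) (unified_product m d)"
  proof (rule jordan_algebra_on_transport)
    show "module smul" "module P.scale" "P.p.subspace (A \<times> V)"
      by (simp_all add: P.p.module_axioms module_axioms P.subspace_Times subspace_A subspace_V)
    show "linear_on smul P.scale UNIV (A \<times> V) (\<lambda>e. (pa e, pv e))"
      by (auto simp: linear_on_def P.scale_prod pa_in pv_in pa_add pv_add pa_scale pv_scale)
    show "range (\<lambda>e. (pa e, pv e)) = A \<times> V"
      by (auto simp: image_iff pa_in pv_in) (metis pa_eq pv_eq)
    show "jordan_algebra_on smul UNIV M"
      using M by (simp add: jordan_extensions_def)
  qed (rule prod)
  with data have "d \<in> jordan_extending_structures smul A m V"
    by (simp add: jordan_extending_structures_def)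
  moreover have "M = datum_mult d"
    by (intro ext) (simp add: datum_mult_def prod pa_pv)
  ultimately show ?thesis by blast
qed

lemma bij_betw_datum_mult:
  "bij_betw datum_mult (jordan_extending_structures smul A m V) (jordan_extensions smul A m)"
  using inj_on_datum_mult datum_mult_in_extensions datum_mult_surj
  by (auto simp: bij_betw_def)

text \<open>The four defining equations are the components of the multiplicativity conditions in
  \<open>ext_equiv_iff\<close>: products of \<open>V\<close> with \<open>A\<close> give those for
  \<open>la'\<close> and \<open>ra'\<close>, products within \<open>V\<close> those for
  \<open>f'\<close> and \<open>mV'\<close>.\<close>

lemma datum_equiv_iff:
  assumes d: "d \<in> jordan_extending_structures smul A m V"
    and d': "d' \<in> jordan_extending_structures smul A m V"
  shows "(d, d') \<in> datum_equiv smul A m V \<longleftrightarrow> (datum_mult d, datum_mult d') \<in> ext_equiv smul A m"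
proof -
  obtain la ra f mV la' ra' f' mV'
    where dd: "d = (la, ra, f, mV)" "d' = (la', ra', f', mV')" by (metis prod_cases4)
  note d1 = d[unfolded dd] and d1' = d'[unfolded dd]
  note B = structure_props(1-4)[OF d1, THEN bilinear_onD(1)]
    structure_props(1-4)[OF d1', THEN bilinear_onD(1)] bilinear_onD(1)[OF bilinear_m]
  let ?cond = "\<lambda>r v a x1 y1 x y.
            la' x a = v (la x1 a) \<and>
            ra' x a = r (la x1 a) + ra x1 a - m a (r x1) \<and>
            f' x y = f x1 y1 + r (mV x1 y1) + m (r x1) (r y1)
                     - r (la x1 (r y1)) - ra x1 (r y1) - r (la y1 (r x1)) - ra y1 (r x1) \<and>
            mV' x y = v (mV x1 y1) - v (la x1 (r y1)) - v (la y1 (r x1))"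
  let ?equiv = "\<lambda>r v. \<forall>a\<in>A. \<forall>x\<in>V. \<forall>y\<in>V.
          let x1 = inv_into V v x; y1 = inv_into V v y in ?cond r v a x1 y1 x y"
  let ?hom = "\<lambda>r v. (\<forall>x\<in>V. \<forall>a\<in>A. stab r v (datum_mult d x a) = datum_mult d' (r x + v x) a) \<and>
      (\<forall>x\<in>V. \<forall>y\<in>V. stab r v (datum_mult d x y) = datum_mult d' (r x + v x) (r y + v y))"
  have equiv_hom: "?equiv r v \<longleftrightarrow> ?hom r v"
    if r: "linear_on smul smul V A r" and v: "linear_on smul smul V V v" and bij: "bij_betw v V V"
    for r v
  proof -
    note C = linear_onD(1)[OF r] linear_onD(1)[OF v] B closed
    have va: "stab r v (datum_mult d x a) = datum_mult d' (r x + v x) a \<longleftrightarrow>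
      la' (v x) a = v (la x a) \<and> ra' (v x) a = r (la x a) + ra x a - m a (r x)"
      if "x \<in> V" "a \<in> A" for x a
    proof -
      have "stab r v (datum_mult d x a) = (ra x a + r (la x a)) + v (la x a)"
        using that C by (simp add: dd datum_mult_values[OF d1] stab_def pa_eq pv_eq)
      moreover have "datum_mult d' (r x + v x) a = (m a (r x) + ra' (v x) a) + la' (v x) a"
        using that C m_commute[of a "r x"] by (simp add: dd datum_mult_values[OF d1'])
      ultimately have "stab r v (datum_mult d x a) = datum_mult d' (r x + v x) a \<longleftrightarrow>
        ra x a + r (la x a) = m a (r x) + ra' (v x) a \<and> v (la x a) = la' (v x) a"
        using that C by (simp add: components_eq_iff)
      then show ?thesis by (auto simp: algebra_simps)
    qed
    \<comment> \<open>This equivalence presupposes the equations for \<open>la'\<close> and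
      \<open>ra'\<close>, which eliminate the primed actions on \<open>r x\<close> and
      \<open>r y\<close>.\<close>
    have vv: "stab r v (datum_mult d x y) = datum_mult d' (r x + v x) (r y + v y) \<longleftrightarrow>
        f' (v x) (v y) = f x y + r (mV x y) + m (r x) (r y)
          - r (la x (r y)) - ra x (r y) - r (la y (r x)) - ra y (r x) \<and>
        mV' (v x) (v y) = v (mV x y) - v (la x (r y)) - v (la y (r x))"
      if xy: "x \<in> V" "y \<in> V"
        and la': "\<And>x a. x \<in> V \<Longrightarrow> a \<in> A \<Longrightarrow> la' (v x) a = v (la x a)"
        and ra': "\<And>x a. x \<in> V \<Longrightarrow> a \<in> A \<Longrightarrow> ra' (v x) a = r (la x a) + ra x a - m a (r x)" for x y
    proof -
      have "stab r v (datum_mult d x y) = (f x y + r (mV x y)) + v (mV x y)"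
        using xy C by (simp add: dd datum_mult_values[OF d1] stab_def pa_eq pv_eq)
      moreover have "datum_mult d' (r x + v x) (r y + v y) =
        (m (r x) (r y) + ra' (v x) (r y) + ra' (v y) (r x) + f' (v x) (v y)) +
        (la' (v x) (r y) + la' (v y) (r x) + mV' (v x) (v y))"
        using xy C by (simp add: dd datum_mult_eq)
      ultimately have "stab r v (datum_mult d x y) = datum_mult d' (r x + v x) (r y + v y) \<longleftrightarrow>
        f x y + r (mV x y) =
          m (r x) (r y) + ra' (v x) (r y) + ra' (v y) (r x) + f' (v x) (v y) \<and>
        v (mV x y) = la' (v x) (r y) + la' (v y) (r x) + mV' (v x) (v y)"
        using xy C by (simp add: components_eq_iff)
      \<comment> \<open>The two substituted \<open>ra'\<close> terms each contribute
        \<open>- m (r x) (r y)\<close>, up to commutativity, against one explicit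
        \<open>m (r x) (r y)\<close>. Solving for \<open>f'\<close> leaves the single positive
        term.\<close>
      then show ?thesis
        using xy m_commute[of "r x" "r y"] C(1) by (auto simp: la' ra' algebra_simps)
    qed
    have "?equiv r v \<longleftrightarrow> (\<forall>a\<in>A. \<forall>x\<in>V. \<forall>y\<in>V. ?cond r v a x y (v x) (v y))"
      unfolding Let_def by (rule ball_cong[OF refl], rule ball_inv_into[OF bij, of "?cond r v a" for a])
    also have "\<dots> \<longleftrightarrow> ?hom r v"
    \<comment> \<open>\<open>?cond\<close> is quantified over \<open>a\<close>, \<open>x\<close>,
      \<open>y\<close> jointly. To extract the equations of only some of these variables, the
      remaining ones are set to zero, which lies in both \<open>A\<close> and
      \<open>V\<close>.\<close>
    proof (intro iffI conjI ballI, goal_cases)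
      case (1 x a) then show ?case using va closed(6) by blast
    next
      case (2 x y) then show ?case using vv closed(1,6) by blast
    next
      case (3 a x y) then show ?case using va by blast
    next
      case (4 a x y) then show ?case using va by blast
    next
      case (5 a x y) then show ?case using va vv by blast
    next
      case (6 a x y) then show ?case using va vv by blast
    qed
    finally show ?thesis .
  qed
  have "(\<exists>r v. linear_on smul smul V A r \<and> linear_on smul smul V V v \<and> bij_betw v V V \<and> ?equiv r v)
    \<longleftrightarrow> (\<exists>r v. linear_on smul smul V A r \<and> linear_on smul smul V V v \<and> bij_betw v V V \<and> ?hom r v)"
    by (intro iff_exI conj_cong refl equiv_hom)
  then show ?thesis
    unfolding ext_equiv_iff[OF datum_mult_in_extensions[OF d] datum_mult_in_extensions[OF d']]
    using d1 d1' by (simp only: dd datum_equiv_def mem_Collect_eq prod.case simp_thms)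
qed


end

section \<open>Flag data\<close>

locale codim_one_jordan = complemented_jordan +
  fixes x :: 'b
  assumes basis: "is_basis_of smul {x} V"
begin

section \<open>Coordinates along the basis vector \<open>x\<close>\<close>

lemma x_nonzero: "x \<noteq> 0" and V_eq: "V = range (\<lambda>s. smul s x)"
  using basis by (auto simp: is_basis_of_def span_singleton)

lemma x_in_V: "x \<in> V" and scale_x_in_V: "smul s x \<in> V"
  using V_eq scale_one[of x] by (metis rangeI, auto)

text \<open>The coordinate along \<open>x\<close>: \<open>e \<mapsto> (pa e, co e)\<close> inverts
  \<open>(a, s) \<mapsto> a + smul s x\<close> on \<open>A \<times> UNIV\<close>.\<close>

definition co :: "'b \<Rightarrow> 'a" where "co e = (THE s. pv e = smul s x)"

lemma co_eq: "a \<in> A \<Longrightarrow> co (a + smul s x) = s"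
  unfolding co_def by (rule the_equality) (auto simp: pv_eq scale_x_in_V x_nonzero)

lemma pv_eq_co: "pv e = smul (co e) x"
proof -
  obtain s where "pv e = smul s x" using pv_in V_eq by blast
  then show ?thesis using co_eq[OF pa_in, of e s] pa_pv[of e] by simp
qed

lemma pa_co: "pa e + smul (co e) x = e"
  using pa_pv by (simp add: pv_eq_co)

lemma pa_line: "a \<in> A \<Longrightarrow> pa (a + smul s x) = a"
  by (simp add: pa_eq scale_x_in_V)

lemma co_A: "a \<in> A \<Longrightarrow> co a = 0" and co_scale_x: "co (smul s x) = s"
  using co_eq[of a 0] co_eq[of 0 s] closed by simp_all

lemma co_add: "co (e + e') = co e + co e'" and co_scale: "co (smul c e) = c * co e"
proof -
  have "smul (co (e + e')) x = smul (co e + co e') x" "smul (co (smul c e)) x = smul (c * co e) x"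
    using pv_add[of e e'] pv_scale[of c e] by (simp_all add: pv_eq_co scale_left_distrib)
  then show "co (e + e') = co e + co e'" "co (smul c e) = c * co e"
    using x_nonzero by simp_all
qed

lemma line_eq_iff:
  "a \<in> A \<Longrightarrow> b \<in> A \<Longrightarrow> a + smul s x = b + smul t x \<longleftrightarrow> a = b \<and> s = t"
  using components_eq_iff[of a b "smul s x" "smul t x"] x_nonzero by (simp add: scale_x_in_V)

lemma flag_extension_eq:
  "flag_extension smul A m x q y z =
    (case flag_mult smul m q (pa y, co y) (pa z, co z) of (a, s) \<Rightarrow> a + smul s x)"
proof -
  have "inv_into (A \<times> UNIV) (\<lambda>(a, s). a + smul s x) e = (pa e, co e)" for e
    by (rule inv_into_f_eq) (auto intro!: inj_onI simp: line_eq_iff pa_in pa_co)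
  then show ?thesis by (simp add: flag_extension_def)
qed

lemma flag_extension_line:
  assumes "a \<in> A" "b \<in> A"
  shows "flag_extension smul A m x (D, l, a0, \<alpha>0) (a + smul s x) (b + smul t x) =
    (m a b + smul t (D a) + smul s (D b) + smul (s * t) a0) + smul (t * l a + s * l b + s * t * \<alpha>0) x"
  using assms by (simp add: flag_extension_eq flag_mult_def pa_line co_eq)

section \<open>Flag data as Jordan structures on the whole space\<close>

lemma flag_props:
  assumes "(D, l, a0, \<alpha>0) \<in> flag_data smul A m"
  shows "linear_on smul smul A A D" "linear_on smul (*) A UNIV l" "a0 \<in> A"
    "D \<in> A \<rightarrow>\<^sub>E A" "l \<in> A \<rightarrow>\<^sub>E UNIV" "D 0 = 0" "l 0 = 0"
proof -
  show D: "linear_on smul smul A A D" and l: "linear_on smul (*) A UNIV l" and "a0 \<in> A"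
    "D \<in> A \<rightarrow>\<^sub>E A" "l \<in> A \<rightarrow>\<^sub>E UNIV"
    using assms by (simp_all add: flag_data_def)
  show "D 0 = 0" "l 0 = 0"
    using linear_onD(3)[OF D, of 0 0] linear_onD(3)[OF l, of 0 0] closed by simp_all
qed

text \<open>The products \<open>M x a\<close> and \<open>M x x\<close> display the flag datum. The
  last two formulas concern \<open>r + smul u x\<close>, the general form of the image of
  \<open>x\<close> under a map fixing \<open>A\<close>.\<close>

lemma flag_extension_values:
  assumes q: "(D, l, a0, \<alpha>0) \<in> flag_data smul A m"
  defines "M \<equiv> flag_extension smul A m x (D, l, a0, \<alpha>0)"
  shows "a \<in> A \<Longrightarrow> b \<in> A \<Longrightarrow> M a b = m a b"
    and "a \<in> A \<Longrightarrow> M x a = D a + smul (l a) x"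
    and "M x x = a0 + smul \<alpha>0 x"
    and "a \<in> A \<Longrightarrow> r \<in> A \<Longrightarrow> M (r + smul u x) a = (m r a + smul u (D a)) + smul (u * l a) x"
    and "r \<in> A \<Longrightarrow> M (r + smul u x) (r + smul u x) =
      (m r r + smul (2 * u) (D r) + smul (u\<^sup>2) a0) + smul (2 * u * l r + u\<^sup>2 * \<alpha>0) x"
proof -
  note Z = flag_props(6,7)[OF q] bilinear_on_zero[OF bilinear_m] closed
  show "M a b = m a b" if "a \<in> A" "b \<in> A"
    using flag_extension_line[of a b D l a0 \<alpha>0 0 0] that by (simp add: M_def)
  show 1: "M (r + smul u x) a = (m r a + smul u (D a)) + smul (u * l a) x"
    if "a \<in> A" "r \<in> A" for a r u
    using flag_extension_line[of r a D l a0 \<alpha>0 u 0] that by (simp add: M_def)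
  show "M x a = D a + smul (l a) x" if "a \<in> A"
    using 1[of a 0 1] that by (simp add: Z)
  show "M x x = a0 + smul \<alpha>0 x"
    using flag_extension_line[of 0 0 D l a0 \<alpha>0 1 1] by (simp add: M_def Z)
  have "smul (2 * u) (D r) = smul u (D r) + smul u (D r)"
    by (simp flip: scale_left_distrib)
  then show "M (r + smul u x) (r + smul u x) =
      (m r r + smul (2 * u) (D r) + smul (u\<^sup>2) a0) + smul (2 * u * l r + u\<^sup>2 * \<alpha>0) x" if "r \<in> A"
    using flag_extension_line[of r r D l a0 \<alpha>0 u u] that
    by (simp add: M_def power2_eq_square add.assoc)
qed

lemma flag_extension_in_extensions:
  assumes "q \<in> flag_data smul A m"
  shows "flag_extension smul A m x q \<in> jordan_extensions smul A m"
proof -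
  interpret P: module_prod smul "(*)" by (rule module_prod_smul_mult)
  have "jordan_algebra_on smul UNIV (flag_extension smul A m x q)"
  proof (rule jordan_algebra_on_transport)
    show "module P.scale" "module smul" "subspace UNIV"
      by (simp_all add: P.p.module_axioms module_axioms)
    show "linear_on P.scale smul (A \<times> UNIV) UNIV (\<lambda>(a, s). a + smul s x)"
      by (auto simp: linear_on_def P.scale_prod scale_right_distrib scale_left_distrib)
    show "(\<lambda>(a, s). a + smul s x) ` (A \<times> UNIV) = UNIV"
      by (auto simp: image_iff) (metis pa_in pa_co)
    show "jordan_algebra_on P.scale (A \<times> UNIV) (flag_mult smul m q)"
      using assms by (auto simp: flag_data_def)
  qed (auto simp: flag_extension_eq pa_line co_eq)
  with assms show ?thesis
    by (cases q) (auto simp: jordan_extensions_def flag_extension_values)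
qed

lemma inj_on_flag_extension: "inj_on (flag_extension smul A m x) (flag_data smul A m)"
proof (rule inj_onI)
  fix q q'
  assume "q \<in> flag_data smul A m" "q' \<in> flag_data smul A m"
    and eq: "flag_extension smul A m x q = flag_extension smul A m x q'"
  moreover obtain D l a0 \<alpha>0 D' l' a0' \<alpha>0'
    where qq: "q = (D, l, a0, \<alpha>0)" "q' = (D', l', a0', \<alpha>0')" by (metis prod_cases4)
  ultimately have q: "(D, l, a0, \<alpha>0) \<in> flag_data smul A m"
    and q': "(D', l', a0', \<alpha>0') \<in> flag_data smul A m" by auto
  note p = flag_props[OF q] and p' = flag_props[OF q']
  have Dl: "D a = D' a \<and> l a = l' a" if "a \<in> A" for a
    using eq flag_extension_values(2)[OF q that] flag_extension_values(2)[OF q' that]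
      linear_onD(1)[OF p(1) that] linear_onD(1)[OF p'(1) that]
    by (simp add: qq line_eq_iff)
  have "a0 = a0' \<and> \<alpha>0 = \<alpha>0'"
    using eq flag_extension_values(3)[OF q] flag_extension_values(3)[OF q'] p(3) p'(3)
    by (simp add: qq line_eq_iff)
  then show "q = q'"
    using PiE_ext[OF p(4) p'(4)] PiE_ext[OF p(5) p'(5)] Dl by (simp add: qq)
qed

lemma flag_extension_surj:
  assumes M: "M \<in> jordan_extensions smul A m"
  shows "M \<in> flag_extension smul A m x ` flag_data smul A m"
proof -
  interpret P: module_prod smul "(*)" by (rule module_prod_smul_mult)
  note E = extension_props[OF M]
  \<comment> \<open>The coordinates of \<open>M x a\<close> and \<open>M x x\<close>, as
    \<open>flag_extension_values\<close> forces.\<close>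
  define D where "D = (\<lambda>a\<in>A. pa (M x a))"
  define l where "l = (\<lambda>a\<in>A. co (M x a))"
  define q where "q = (D, l, pa (M x x), co (M x x))"
  have D: "linear_on smul smul A A D" and l: "linear_on smul (*) A UNIV l"
    by (auto simp: D_def l_def linear_on_def E(2,4) pa_in pa_add pa_scale co_add co_scale closed)
  have prod: "flag_mult smul m q (pa e, co e) (pa e', co e') = (pa (M e e'), co (M e e'))" for e e'
  proof -
    have "M e e' = M (pa e + smul (co e) x) (pa e' + smul (co e') x)" by (simp add: pa_co)
    also have "\<dots> = m (pa e) (pa e') + smul (co e') (M x (pa e)) + smul (co e) (M x (pa e'))
        + smul (co e * co e') (M x x)"
      by (simp add: E(1-4) E(5)[of "pa e" x] E(6)[OF pa_in pa_in] scale_right_distrib add_ac)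
    finally show ?thesis
      by (simp add: q_def D_def l_def flag_mult_def pa_add co_add pa_scale co_scale pa_in pa_A co_A
          bilinear_onD(1)[OF bilinear_m])
  qed
  have "jordan_algebra_on P.scale (A \<times> UNIV) (flag_mult smul m q)"
  proof (rule jordan_algebra_on_transport)
    show "module smul" "module P.scale" "P.p.subspace (A \<times> UNIV)"
      by (simp_all add: P.p.module_axioms module_axioms P.subspace_Times subspace_A)
    show "linear_on smul P.scale UNIV (A \<times> UNIV) (\<lambda>e. (pa e, co e))"
      by (auto simp: linear_on_def P.scale_prod pa_in pa_add pa_scale co_add co_scale)
    show "range (\<lambda>e. (pa e, co e)) = A \<times> UNIV"
      by (auto simp: image_iff pa_in) (metis pa_line co_eq)
    show "jordan_algebra_on smul UNIV M"
      using M by (simp add: jordan_extensions_def)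
  qed (rule prod)
  then have "q \<in> flag_data smul A m"
    using D l by (auto simp: flag_data_def q_def pa_in) (auto simp: D_def l_def pa_in)
  moreover have "M = flag_extension smul A m x q"
    by (intro ext) (simp add: flag_extension_eq prod pa_co)
  ultimately show ?thesis by blast
qed

lemma bij_betw_flag_extension:
  "bij_betw (flag_extension smul A m x) (flag_data smul A m) (jordan_extensions smul A m)"
  using inj_on_flag_extension flag_extension_in_extensions flag_extension_surj
  by (auto simp: bij_betw_def)

text \<open>On the line \<open>V\<close>, a linear map into \<open>A\<close> amounts to the image
  \<open>r\<close> of \<open>x\<close>, and an automorphism to a nonzero scalar \<open>u\<close>. By
  homogeneity the conditions of \<open>ext_equiv_iff\<close> reduce to the products of
  \<open>x\<close> with \<open>A\<close> and with itself. The left-hand sides are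
  \<open>stab\<close> in coordinates.\<close>

lemma ext_equiv_iff_line:
  assumes M: "M \<in> jordan_extensions smul A m" and M': "M' \<in> jordan_extensions smul A m"
  shows "(M, M') \<in> ext_equiv smul A m \<longleftrightarrow>
    (\<exists>r\<in>A. \<exists>u. u \<noteq> 0 \<and>
      (\<forall>a\<in>A. (pa (M x a) + smul (co (M x a)) r) + smul (co (M x a) * u) x = M' (r + smul u x) a) \<and>
      (pa (M x x) + smul (co (M x x)) r) + smul (co (M x x) * u) x = M' (r + smul u x) (r + smul u x))"
    (is "?L \<longleftrightarrow> ?R")
proof
  assume ?L
  then obtain r v where r: "linear_on smul smul V A r" and v: "linear_on smul smul V V v"
    and bij: "bij_betw v V V"
    and va: "\<And>y a. y \<in> V \<Longrightarrow> a \<in> A \<Longrightarrow> stab r v (M y a) = M' (r y + v y) a"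
    and vv: "\<And>y z. y \<in> V \<Longrightarrow> z \<in> V \<Longrightarrow> stab r v (M y z) = M' (r y + v y) (r z + v z)"
    unfolding ext_equiv_iff[OF M M'] by blast
  note R = linear_onD[OF r] and L = linear_onD[OF v]
  define u where "u = co (v x)"
  have vx: "v x = smul u x"
    using L(1)[OF x_in_V] pv_eq_co[of "v x"] by (simp add: u_def pv_V)
  have "v 0 = 0" using L(3)[OF closed(6), of 0] by simp
  \<comment> \<open>Otherwise \<open>v x = 0 = v 0\<close>, against injectivity of
    \<open>v\<close>.\<close>
  then have "u \<noteq> 0"
    using bij_betw_imp_inj_on[OF bij, THEN inj_onD, of x 0] vx x_nonzero x_in_V closed(6) by auto
  moreover have "stab r v e = (pa e + smul (co e) (r x)) + smul (co e * u) x" for e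
    by (simp add: stab_def pv_eq_co R(3)[OF x_in_V] L(3)[OF x_in_V] vx)
  ultimately show ?R
    using va[OF x_in_V] vv[OF x_in_V x_in_V] R(1)[OF x_in_V] vx
    by (intro bexI[of _ "r x"] exI[of _ u]) simp_all
next
  assume ?R
  then obtain r u where r: "r \<in> A" and u: "u \<noteq> 0"
    and va: "\<And>a. a \<in> A \<Longrightarrow> (pa (M x a) + smul (co (M x a)) r) + smul (co (M x a) * u) x = M' (r + smul u x) a"
    and vv: "(pa (M x x) + smul (co (M x x)) r) + smul (co (M x x) * u) x = M' (r + smul u x) (r + smul u x)"
    by blast
  \<comment> \<open>The linear extensions from the basis vector with \<open>R x = r\<close> and
    \<open>v x = smul u x\<close>.\<close>
  define R where "R = (\<lambda>e. smul (co e) r)"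
  define v where "v = (\<lambda>e. smul (co e * u) x)"
  have linR: "linear_on smul smul V A R" and linv: "linear_on smul smul V V v"
    by (auto simp: linear_on_def R_def v_def r closed scale_x_in_V co_add co_scale
        scale_left_distrib distrib_right mult.assoc)
  have bij: "bij_betw v V V"
  proof (rule bij_betw_imageI)
    show "inj_on v V"
    proof (rule inj_onI)
      fix y z assume "y \<in> V" "z \<in> V" "v y = v z"
      then have "pv y = pv z" using u x_nonzero by (simp add: v_def pv_eq_co)
      with \<open>y \<in> V\<close> \<open>z \<in> V\<close> show "y = z" by (simp add: pv_V)
    qed
    show "v ` V = V"
    proof
      show "v ` V \<subseteq> V" by (auto simp: v_def scale_x_in_V)
      show "V \<subseteq> v ` V"
      proof
        fix y assume "y \<in> V"
        then obtain s where "y = smul s x" using V_eq by blast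
        then have "y = v (smul (s / u) x)" using u by (simp add: v_def co_scale_x)
        then show "y \<in> v ` V" using scale_x_in_V by blast
      qed
    qed
  qed
  note S = stab_linear_bij(1)[OF linR linv bij, unfolded linear_iff_add_scale]
  have stab: "stab R v e = (pa e + smul (co e) r) + smul (co e * u) x" for e
    by (simp add: stab_def R_def v_def pv_eq_co co_scale_x)
  have line: "R (smul s x) + v (smul s x) = smul s (r + smul u x)" for s
    by (simp add: R_def v_def co_scale_x scale_right_distrib)
  note P = extension_props[OF M] and P' = extension_props[OF M']
  have "stab R v (M y a) = M' (R y + v y) a" if yV: "y \<in> V" and aA: "a \<in> A" for y a
  proof -
    obtain s where y: "y = smul s x" using V_eq yV by blast
    have "stab R v (M y a) = smul s (stab R v (M x a))" using S by (simp add: y P(3))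
    also have "\<dots> = smul s (M' (r + smul u x) a)" using va[OF aA] by (simp add: stab)
    finally show ?thesis by (simp only: y line P'(3))
  qed
  moreover have "stab R v (M y z) = M' (R y + v y) (R z + v z)" if yV: "y \<in> V" and zV: "z \<in> V" for y z
  proof -
    obtain s where y: "y = smul s x" using V_eq yV by blast
    obtain t where z: "z = smul t x" using V_eq zV by blast
    have "stab R v (M y z) = smul t (smul s (stab R v (M x x)))"
      using S by (simp add: y z P(3,4))
    also have "\<dots> = smul t (smul s (M' (r + smul u x) (r + smul u x)))" using vv by (simp add: stab)
    finally show ?thesis by (simp only: y z line P'(3,4))
  qed
  ultimately show ?L
    unfolding ext_equiv_iff[OF M M'] using linR linv bij by blast
qed

text \<open>An isomorphism sends \<open>x\<close> to \<open>r + smul u x\<close>. Comparing the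
  coordinates of its products with \<open>A\<close> and of its square yields exactly the equations
  of \<open>flag_equiv\<close>, after cancelling the nonzero \<open>u\<close>.\<close>

lemma flag_equiv_iff:
  assumes q: "q \<in> flag_data smul A m" and q': "q' \<in> flag_data smul A m"
  shows "(q, q') \<in> flag_equiv smul A m \<longleftrightarrow>
    (flag_extension smul A m x q, flag_extension smul A m x q') \<in> ext_equiv smul A m"
proof -
  obtain D l a0 \<alpha>0 D' l' a0' \<alpha>0'
    where qq: "q = (D, l, a0, \<alpha>0)" "q' = (D', l', a0', \<alpha>0')" by (metis prod_cases4)
  note q1 = q[unfolded qq] and q1' = q'[unfolded qq]
  note p = flag_props[OF q1] and p' = flag_props[OF q1']
  note C = linear_onD(1)[OF p(1)] linear_onD(1)[OF p'(1)] p(3) p'(3) closed bilinear_onD(1)[OF bilinear_m]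
  note val = flag_extension_values[OF q1] and val' = flag_extension_values[OF q1']
  let ?M = "flag_extension smul A m x (D, l, a0, \<alpha>0)"
  let ?M' = "flag_extension smul A m x (D', l', a0', \<alpha>0')"
  have xa: "(pa (?M x a) + smul (co (?M x a)) r) + smul (co (?M x a) * u) x = ?M' (r + smul u x) a
      \<longleftrightarrow> l a = l' a \<and> D a = smul u (D' a) + m a r - smul (l' a) r"
    if "r \<in> A" "u \<noteq> 0" "a \<in> A" for r u a
  proof -
    have "(pa (?M x a) + smul (co (?M x a)) r) + smul (co (?M x a) * u) x = ?M' (r + smul u x) a
      \<longleftrightarrow> D a + smul (l a) r = m a r + smul u (D' a) \<and> l a * u = u * l' a"
      using that C m_commute[of a r] by (simp add: val(2) val'(4) pa_line co_eq line_eq_iff)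
    then show ?thesis using that by (auto simp: algebra_simps)
  qed
  have xx: "(pa (?M x x) + smul (co (?M x x)) r) + smul (co (?M x x) * u) x =
        ?M' (r + smul u x) (r + smul u x)
      \<longleftrightarrow> \<alpha>0 = u * \<alpha>0' + 2 * l' r \<and>
        a0 = smul (u\<^sup>2) a0' + m r r + smul (2 * u) (D' r) - smul (u * \<alpha>0') r - smul (2 * l' r) r"
    if "r \<in> A" "u \<noteq> 0" for r u
  proof -
    have "(pa (?M x x) + smul (co (?M x x)) r) + smul (co (?M x x) * u) x =
        ?M' (r + smul u x) (r + smul u x)
      \<longleftrightarrow> a0 + smul \<alpha>0 r = m r r + smul (2 * u) (D' r) + smul (u\<^sup>2) a0' \<and>
        \<alpha>0 * u = 2 * u * l' r + u\<^sup>2 * \<alpha>0'"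
      using that C by (simp add: val(3) val'(5) pa_line co_eq line_eq_iff)
    \<comment> \<open>Cancelling \<open>u\<close> gives the equation for \<open>\<alpha>0\<close>;
      inserting it into the \<open>A\<close> component then produces the two subtracted multiples of
      \<open>r\<close> in the formula for \<open>a0\<close>.\<close>
    also have "\<alpha>0 * u = 2 * u * l' r + u\<^sup>2 * \<alpha>0' \<longleftrightarrow> \<alpha>0 * u = (u * \<alpha>0' + 2 * l' r) * u"
      by (simp add: algebra_simps power2_eq_square)
    also have "\<dots> \<longleftrightarrow> \<alpha>0 = u * \<alpha>0' + 2 * l' r"
      using that by simp
    finally show ?thesis
      by (auto simp: algebra_simps)
  qed
  have ll: "l = l' \<longleftrightarrow> (\<forall>a\<in>A. l a = l' a)"
    using PiE_ext[OF p(5) p'(5)] by blast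
  have "(?M, ?M') \<in> ext_equiv smul A m \<longleftrightarrow> (\<exists>r\<in>A. \<exists>u. u \<noteq> 0 \<and>
      (\<forall>a\<in>A. l a = l' a \<and> D a = smul u (D' a) + m a r - smul (l' a) r) \<and>
      \<alpha>0 = u * \<alpha>0' + 2 * l' r \<and>
      a0 = smul (u\<^sup>2) a0' + m r r + smul (2 * u) (D' r) - smul (u * \<alpha>0') r - smul (2 * l' r) r)"
    unfolding ext_equiv_iff_line[OF q[THEN flag_extension_in_extensions, unfolded qq]
        q'[THEN flag_extension_in_extensions, unfolded qq]]
    by (intro bex_cong refl iff_exI conj_cong ball_cong xa xx)
  \<comment> \<open>The condition on \<open>l\<close> involves neither \<open>r\<close> nor
    \<open>u\<close>, so it leaves the existential quantifier; extensionality makes it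
    \<open>l = l'\<close>.\<close>
  also have "\<dots> \<longleftrightarrow> l = l' \<and> (\<exists>r\<in>A. \<exists>u. u \<noteq> 0 \<and>
      (\<forall>a\<in>A. D a = smul u (D' a) + m a r - smul (l' a) r) \<and>
      \<alpha>0 = u * \<alpha>0' + 2 * l' r \<and>
      a0 = smul (u\<^sup>2) a0' + m r r + smul (2 * u) (D' r) - smul (u * \<alpha>0') r - smul (2 * l' r) r)"
    unfolding ll ball_conj_distrib by blast
  finally show ?thesis
    using q1 q1' by (simp only: qq flag_equiv_def mem_Collect_eq prod.case simp_thms)
qed

end

text \<open>Codimension is witnessed by some complement \<open>W\<close>, possibly different from
  \<open>V\<close>. Projecting a basis vector \<open>w\<close> of \<open>W\<close> to
  \<open>V\<close> along \<open>A\<close> gives a basis of \<open>V\<close>: writing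
  \<open>v = a + smul s w\<close> shows that \<open>pv w\<close> spans, and \<open>pv w = 0\<close>
  would put \<open>w\<close> in both \<open>A\<close> and \<open>W\<close>.\<close>

lemma (in complemented_jordan) codim_one_basis:
  assumes "has_codim smul A 1"
  obtains x where "is_basis_of smul {x} V"
proof -
  obtain W B where W: "is_complement smul A W" and B: "is_basis_of smul B W" "card B = 1"
    using assms by (auto simp: has_codim_def)
  then obtain w where "B = {w}" by (auto simp: card_1_singleton_iff)
  with B have w: "w \<noteq> 0" "W = range (\<lambda>s. smul s w)"
    by (auto simp: is_basis_of_def span_singleton)
  have "v \<in> range (\<lambda>s. smul s (pv w))" if "v \<in> V" for v
  proof -
    obtain a z where "a \<in> A" "z \<in> W" "v = a + z" using W by (metis is_complement_def)
    then obtain s where "v = a + smul s w" using w by blast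
    then have "pv v = smul s (pv w)" using \<open>a \<in> A\<close> by (simp add: pv_add pv_A pv_scale)
    then show ?thesis using that by (metis pv_V rangeI)
  qed
  moreover have "smul s (pv w) \<in> V" for s
    by (rule subspace_scale[OF subspace_V pv_in])
  moreover have "pv w \<noteq> 0"
  proof
    assume "pv w = 0"
    then have "w \<in> A" using pa_in[of w] pa_pv[of w] by simp
    moreover have "w \<in> W" using w(2) scale_one[of w] by (metis rangeI)
    ultimately show False using W w(1) by (auto simp: is_complement_def)
  qed
  ultimately have "is_basis_of smul {pv w} V"
    by (auto simp: is_basis_of_def span_singleton)
  then show ?thesis by (rule that)
qed

theorem theorem2p17:
  fixes smul :: "'k::field \<Rightarrow> 'e::ab_group_add \<Rightarrow> 'e"
    and A V :: "'e set"
    and m :: "'e \<Rightarrow> 'e \<Rightarrow> 'e"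
  assumes "vector_space smul"
    and "(2::'k) \<noteq> 0"
    and "jordan_algebra_on smul A m"
    and "has_codim smul A 1"
    and "is_complement smul A V"
  shows "equiv (flag_data smul A m) (flag_equiv smul A m) \<and>
    (\<exists>\<Phi>. bij_betw \<Phi> (Jext smul A m) (J_classes smul A m V)) \<and>
    (\<exists>\<Psi>. bij_betw \<Psi> (J_classes smul A m V) (flag_data smul A m // flag_equiv smul A m)) \<and>
    (\<forall>x. is_basis_of smul {x} V \<longrightarrow>
      (\<exists>\<Theta>. bij_betw \<Theta> (flag_data smul A m // flag_equiv smul A m) (Jext smul A m) \<and>
        (\<forall>q\<in>flag_data smul A m.
          \<Theta> (flag_equiv smul A m `` {q}) = ext_equiv smul A m `` {flag_extension smul A m x q})))"
proof -
  interpret complemented_jordan smul A V m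
    using assms by (simp add: complemented_jordan_def complemented_jordan_axioms_def)
  have line: "codim_one_jordan smul A V m x" if "is_basis_of smul {x} V" for x
    using that by unfold_locales
  have flag_sub: "flag_equiv smul A m \<subseteq> flag_data smul A m \<times> flag_data smul A m"
    by (auto simp: flag_equiv_def)
  have datum_sub: "datum_equiv smul A m V \<subseteq>
      jordan_extending_structures smul A m V \<times> jordan_extending_structures smul A m V"
    by (auto simp: datum_equiv_def)
  have flags: "\<exists>\<Theta>. bij_betw \<Theta> (flag_data smul A m // flag_equiv smul A m) (Jext smul A m) \<and>
        (\<forall>q\<in>flag_data smul A m.
          \<Theta> (flag_equiv smul A m `` {q}) = ext_equiv smul A m `` {flag_extension smul A m x q})"
    if "is_basis_of smul {x} V" for x
    using bij_betw_quotient[OF equiv_ext_equiv codim_one_jordan.bij_betw_flag_extension[OF line[OF that]]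
        flag_sub codim_one_jordan.flag_equiv_iff[OF line[OF that]]]
    unfolding Jext_def by blast
  \<comment> \<open>Both kinds of classes are mapped to \<open>Jext\<close>; the bijections in the
    remaining directions arise by inversion and composition.\<close>
  obtain \<Xi> where \<Xi>: "bij_betw \<Xi> (J_classes smul A m V) (Jext smul A m)"
    using bij_betw_quotient[OF equiv_ext_equiv bij_betw_datum_mult datum_sub datum_equiv_iff]
    unfolding Jext_def J_classes_def by blast
  \<comment> \<open>One basis vector is chosen for the claims that do not mention it; the last claim
    is proved for every basis vector by \<open>flags\<close>.\<close>
  obtain x where x: "is_basis_of smul {x} V"
    using codim_one_basis[OF assms(4)] by blast
  obtain \<Theta> where \<Theta>: "bij_betw \<Theta> (flag_data smul A m // flag_equiv smul A m) (Jext smul A m)"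
    using flags[OF x] by blast
  show ?thesis
  proof (intro conjI allI impI)
    show "equiv (flag_data smul A m) (flag_equiv smul A m)"
      by (rule equiv_pullback[OF equiv_ext_equiv _ flag_sub
            codim_one_jordan.flag_equiv_iff[OF line[OF x]]])
        (use codim_one_jordan.flag_extension_in_extensions[OF line[OF x]] in auto)
    show "\<exists>\<Phi>. bij_betw \<Phi> (Jext smul A m) (J_classes smul A m V)"
      using bij_betw_inv_into[OF \<Xi>] by blast
    show "\<exists>\<Psi>. bij_betw \<Psi> (J_classes smul A m V) (flag_data smul A m // flag_equiv smul A m)"
      using bij_betw_trans[OF \<Xi> bij_betw_inv_into[OF \<Theta>]] by blast
  qed (rule flags)
qed

end
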